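(* Let $k$ be a positive integer. For the higher order Mersenne numbers $\{M_n^{(k)}\}$ and every integer $s\ge 1$, we have 1. $$\sum_{n=0}^{s-1}\binom{s-1}{n}M_{n}^{(k)}= \frac{(1+2^k)^{s-1}-2^{s-1}}{2^k-1}.$$ 2. $$\sum_{n=0}^{s-1}(-1)^n\binom{s-1}{n}M_{n}^{(k)}=(-1)^{s-1}M_k^{\,s-2}.$$
   Context: The Mersenne numbers $\{M_n\}_{n\ge 0}$ are defined by $M_0=0$, $M_1=1$, $M_{n+2}=3M_{n+1}-2M_n$, i.e. $M_n=2^n-1$. For a positive integer $k$, the higher order Mersenne numbers are $M_n^{(k)}=M_{kn}/M_k$ for $n=0,1,2,\dots$. $M_k^{\,s-2}$ denotes the $(s-2)$th power of $M_k$.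
   Formalization: Identity 2 is stated only for s ≥ 2: at s = 1 it fails for every k ≥ 1, since the left side is M_0^(k) = 0 while the right side is M_k^(-1) = 1/(2^k − 1), which is not zero. *)

theory Defs
  imports Complex_Main
begin

fun mersenne :: "nat \<Rightarrow> int" where
  "mersenne 0 = 0"
| "mersenne (Suc 0) = 1"
| "mersenne (Suc (Suc n)) = 3 * mersenne (Suc n) - 2 * mersenne n"

lemma mersenne_closed_form: "mersenne n = 2 ^ n - 1"
  by (induction n rule: mersenne.induct) (simp_all add: algebra_simps)

(* The quotient is taken in the rationals, so it is the exact quotient
   whether or not it is known to be an integer; it is meaningful for k > 0. *)
definition higher_mersenne :: "nat \<Rightarrow> nat \<Rightarrow> rat" where
  "higher_mersenne k n = of_int (mersenne (k * n)) / of_int (mersenne k)"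

end

theory Submission
  imports Defs
begin

text \<open>With a = 2^k, the term M_n^{(k)} = (a^n - 1)/(a - 1) is a difference of two geometric
  sequences. Summing it against c^n binom(m,n) therefore gives a difference of two binomial
  expansions (\<open>sum_binomial_higher_mersenne\<close>). Both identities are the case m = s - 1,
  with c = 1 and c = -1.\<close>

lemma higher_mersenne_eq:
  "higher_mersenne k n = ((2 ^ k) ^ n - 1) / (2 ^ k - 1)"
  by (simp add: higher_mersenne_def mersenne_closed_form power_mult)

text \<open>The free weight \<open>c\<close> lets one computation serve both the plain and the
  alternating sum.\<close>

lemma sum_binomial_higher_mersenne:
  "(\<Sum>n = 0..m. c ^ n * of_nat (m choose n) * higher_mersenne k n)
     = ((1 + c * 2 ^ k) ^ m - (1 + c) ^ m) / (2 ^ k - 1)"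
proof -
  have binom: "(1 + x) ^ m = (\<Sum>n = 0..m. of_nat (m choose n) * x ^ n)" for x :: rat
    using binomial_ring[of x 1 m] by (simp add: atMost_atLeast0 add.commute)
  show ?thesis
    \<comment> \<open>Both powers on the right are expanded, so the sums can be compared term by
      term.\<close>
    unfolding binom sum_subtractf[symmetric] sum_divide_distrib higher_mersenne_eq
    by (intro sum.cong) (simp_all add: power_mult_distrib algebra_simps)
qed

theorem theorem2p20:
  fixes k s :: nat
  assumes "k \<ge> 1" and "s \<ge> 1"
  shows "(\<Sum>n = 0..s - 1. of_nat ((s - 1) choose n) * higher_mersenne k n)
           = ((1 + 2 ^ k) ^ (s - 1) - 2 ^ (s - 1)) / (2 ^ k - 1)
       \<and> (s \<ge> 2 \<longrightarrow>
           (\<Sum>n = 0..s - 1. (- 1) ^ n * of_nat ((s - 1) choose n) * higher_mersenne k n)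
             = (- 1) ^ (s - 1) * of_int (mersenne k) ^ (s - 2))"
proof (intro conjI impI)
  show "(\<Sum>n = 0..s - 1. of_nat ((s - 1) choose n) * higher_mersenne k n)
          = ((1 + 2 ^ k) ^ (s - 1) - 2 ^ (s - 1)) / (2 ^ k - 1)"
    using sum_binomial_higher_mersenne[where c = 1] by simp
next
  \<comment> \<open>At s = 1 the second identity fails: the sum is M_0^{(k)} = 0, while M_k^{-1} is
    nonzero (and the truncated \<open>s - 2\<close> would give 1).\<close>
  assume "s \<ge> 2"
  then obtain t where s: "s = Suc (Suc t)"
    by (metis add_2_eq_Suc le_Suc_ex)
  define q :: rat where "q = 2 ^ k - 1"
  have "(2 :: rat) ^ k > 1"
    using \<open>k \<ge> 1\<close> by (intro one_less_power) simp_all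
  then have "q \<noteq> 0"
    by (simp add: q_def)
  have "(\<Sum>n = 0..s - 1. (- 1) ^ n * of_nat ((s - 1) choose n) * higher_mersenne k n)
          = (- q) ^ Suc t / q"
    \<comment> \<open>Here (1 + c)^m vanishes because m = \<open>Suc t\<close> is positive, and 1 -
      2^k = -q; the denominator then cancels one factor of \<open>q\<close>.\<close>
    using sum_binomial_higher_mersenne[where c = "- 1" and m = "Suc t"] by (simp add: s q_def)
  also have "\<dots> = (- 1) ^ Suc t * q ^ t"
    using \<open>q \<noteq> 0\<close> by (simp add: power_minus[of q])
  finally show "(\<Sum>n = 0..s - 1. (- 1) ^ n * of_nat ((s - 1) choose n) * higher_mersenne k n)
                  = (- 1) ^ (s - 1) * of_int (mersenne k) ^ (s - 2)"
    by (simp add: s q_def mersenne_closed_form)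
qed

end
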